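(* Let $p>m\ge n>q\ge 0$ be integers satisfying $m+n=p+q$. For a real number $c$ and $x>0$ let $$F_{p,m,n,q}(x;c)=(-1)^{m+n}\psi^{(m)}(x)\psi^{(n)}(x)-c\,(-1)^{p+q}\psi^{(p)}(x)\psi^{(q)}(x),$$ where, by convention, $\psi^{(0)}(x)$ is replaced by the constant $-1$. Let $$c_{p,m,n,q}=\frac{(m-1)!\,(n-1)!}{(p-1)!\,(q-1)!}\ \text{ if } q\ge 1,\qquad c_{p,m,n,0}=\frac{(m-1)!\,(n-1)!}{(p-1)!},\qquad d_{p,m,n,q}=\frac{m!\,n!}{p!\,q!}.$$ Then the function $x\mapsto F_{p,m,n,q}(x;c_{p,m,n,q})$ is completely monotonic on $(0,+\infty)$. Moreover, when $q>0$, the function $x\mapsto -F_{p,m,n,q}(x;d_{p,m,n,q})$ is completely monotonic on $(0,+\infty)$.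
   Context: $\psi=\Gamma'/\Gamma$ is the logarithmic derivative of Euler's gamma function, and $\psi^{(k)}$ for $k\ge1$ is its $k$-th derivative; in this statement only, the symbol $\psi^{(0)}(x)$ means the constant $-1$ (not $\psi(x)$). A function $f$ is completely monotonic on an interval $(a,b)$ if it has derivatives of all orders there and $(-1)^kf^{(k)}(x)\ge 0$ for all $x\in(a,b)$ and all integers $k\ge 0$. *)

theory Defs
  imports "HOL-Analysis.Analysis"
begin

text \<open>
  Intended for open intervals \<open>I\<close>: on these the two-sided derivatives depend only on the
  restriction of \<open>f\<close> to \<open>I\<close>.  Differentiability of every iterated derivative is required
  explicitly because \<^const>\<open>deriv\<close> is a total function.
\<close>
definition completely_monotonic_on :: "real set \<Rightarrow> (real \<Rightarrow> real) \<Rightarrow> bool" where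
  "completely_monotonic_on I f \<longleftrightarrow>
     (\<forall>k. \<forall>x\<in>I. (deriv ^^ k) f differentiable (at x)) \<and>
     (\<forall>k. \<forall>x\<in>I. (-1) ^ k * (deriv ^^ k) f x \<ge> 0)"

text \<open>
  The symbol $\psi^{(k)}$ under the convention that $\psi^{(0)}$ is the constant $-1$
  (and not the digamma function).
\<close>
definition psi :: "nat \<Rightarrow> real \<Rightarrow> real" where
  "psi k x = (if k = 0 then -1 else Polygamma k x)"

text \<open>
  The library's \<^const>\<open>Polygamma\<close> is defined by a series; on the positive half-line it is
  the iterated derivative of $\Gamma'/\Gamma$.
\<close>
lemma Polygamma_eq_deriv_log_Gamma:
  fixes x :: real
  assumes "x > 0"
  shows "Polygamma k x = (deriv ^^ k) (\<lambda>t. deriv Gamma t / Gamma t) x"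
  using assms
proof (induction k arbitrary: x)
  case 0
  then have "x \<notin> \<int>\<^sub>\<le>\<^sub>0"
    by (auto elim!: nonpos_Ints_cases)
  then have "(Gamma has_field_derivative Gamma x * Digamma x) (at x)"
    by (rule has_field_derivative_Gamma)
  then have "deriv Gamma x = Gamma x * Digamma x"
    by (rule DERIV_imp_deriv)
  moreover have "Gamma x \<noteq> 0"
    using Gamma_real_pos[OF 0] by simp
  ultimately show ?case
    by simp
next
  case (Suc k)
  have "eventually (\<lambda>y. y \<in> {0<..}) (nhds x)"
    using Suc.prems by (intro eventually_nhds_in_open) auto
  then have "eventually (\<lambda>y. (deriv ^^ k) (\<lambda>t. deriv Gamma t / Gamma t) y = Polygamma k y) (nhds x)"
    by eventually_elim (simp add: Suc.IH)
  then have "deriv ((deriv ^^ k) (\<lambda>t. deriv Gamma t / Gamma t)) x = deriv (Polygamma k) x"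
    by (rule deriv_cong_ev) simp
  moreover have "x \<notin> \<int>\<^sub>\<le>\<^sub>0"
    using Suc.prems by (auto elim!: nonpos_Ints_cases)
  then have "deriv (Polygamma k) x = Polygamma (Suc k) x"
    by (intro DERIV_imp_deriv has_field_derivative_Polygamma)
  ultimately show ?case
    by simp
qed

definition F :: "nat \<Rightarrow> nat \<Rightarrow> nat \<Rightarrow> nat \<Rightarrow> real \<Rightarrow> real \<Rightarrow> real" where
  "F p m n q c x = (-1) ^ (m + n) * psi m x * psi n x - c * (-1) ^ (p + q) * psi p x * psi q x"

definition c_const :: "nat \<Rightarrow> nat \<Rightarrow> nat \<Rightarrow> nat \<Rightarrow> real" where
  "c_const p m n q =
     (if q \<ge> 1 then fact (m - 1) * fact (n - 1) / (fact (p - 1) * fact (q - 1))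
      else fact (m - 1) * fact (n - 1) / fact (p - 1))"

definition d_const :: "nat \<Rightarrow> nat \<Rightarrow> nat \<Rightarrow> nat \<Rightarrow> real" where
  "d_const p m n q = fact m * fact n / (fact p * fact q)"

end

theory Submission
  imports Defs "HOL-Probability.Distributions"
begin

text \<open>
  With $g_k = (-1)^{k+1}\psi^{(k)}$ one has
  $g_k(x) = \int_0^\infty t^k h(t) e^{-xt}\,dt$ for $k \ge 1$, where $h(t) = 1/(1-e^{-t})$.
  Hence every derivative of $g_m g_n - c\,g_p g_q$ is, up to sign, the integral over $r > 0$ of
  $r^k e^{-xr}$ times $\int_0^r (s^m (r-s)^n - c\,s^p (r-s)^q)\,h(s) h(r-s)\,ds$, and it suffices to
  find the sign of the inner integral. After symmetrisation in $s \mapsto r-s$ the quotient of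
  $s^m (r-s)^n$ by $s^p (r-s)^q$ increases towards $s = r/2$. The weight $h(s)h(r-s)$ decreases towards
  $r/2$, while $s h(s) \cdot (r-s) h(r-s)$ increases because $t h(t)$ is log-concave.
  Chebyshev's integral inequality therefore bounds the quotient of the weighted integrals by the
  quotient of the Beta integrals: with exponents $m, n, p, q$ this gives the constant $d$, with all
  exponents lowered by one the constant $c$. For $q = 0$ one uses
  $s h(s) \cdot (r-s) h(r-s) \ge r h(r)$ instead.
\<close>

subsection \<open>The kernel of the Laplace representation\<close>

text \<open>This is the sum of the geometric series of \<open>exp (- j * t)\<close> over j >= 0 for
  t > 0. It appears when the terms of the polygamma series are written as Laplace integrals and
  added.\<close>

definition bose :: "real \<Rightarrow> real" where
  "bose t = 1 / (1 - exp (- t))"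

lemma bose_pos: "t > 0 \<Longrightarrow> bose t > 0"
  by (simp add: bose_def)

lemma measurable_bose [measurable]: "bose \<in> borel_measurable borel"
  unfolding bose_def by measurable

text \<open>The denominator expands to \<open>1 + exp (- r)\<close> minus
  \<open>exp (- s) + exp (- (r - s))\<close>, and the last sum shrinks as s moves towards
  r/2.\<close>

lemma bose_product_antimono:
  assumes "0 < u" "u \<le> v" "v \<le> r / 2"
  shows "bose v * bose (r - v) \<le> bose u * bose (r - u)"
proof -
  define E where "E = (\<lambda>s. (1 - exp (- s)) * (1 - exp (- (r - s))))"
  \<comment> \<open>These two inequalities give the signs of the factors into which
    \<open>E v - E u\<close> splits.\<close>
  have "exp u \<le> exp v" "exp (- r) \<le> exp (- u - v)"
    using assms by simp_all
  then have "(exp v - exp u) * (exp (- u - v) - exp (- r)) \<ge> 0"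
    by (intro mult_nonneg_nonneg) simp_all
  also have "(exp v - exp u) * (exp (- u - v) - exp (- r)) = E v - E u"
    by (simp add: E_def algebra_simps flip: exp_add)
  finally have "E u \<le> E v"
    by simp
  moreover have "E u > 0"
    using assms by (simp add: E_def)
  ultimately have "1 / E v \<le> 1 / E u"
    by (intro divide_left_mono) auto
  then show ?thesis
    by (simp add: E_def bose_def)
qed

text \<open>This is s <= 2 sinh(s/2), multiplied by \<open>exp (s / 2)\<close> and squared. The
  function \<open>f\<close> is 2 sinh(t/2) - t, with derivative cosh(t/2) - 1, which is half a
  square.\<close>

lemma two_sinh_half_ge:
  fixes s :: real
  assumes "s > 0"
  shows "s\<^sup>2 * exp s \<le> (exp s - 1)\<^sup>2"
proof -
  define f where "f = (\<lambda>t::real. exp (t / 2) - exp (- t / 2) - t)"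
  have "f 0 \<le> f s"
  proof (rule DERIV_nonneg_imp_nondecreasing[of 0 s])
    fix t :: real
    have "exp (t / 2) * exp (- t / 2) = 1"
      by (simp flip: exp_add)
    then have "exp (t / 2) / 2 + exp (- t / 2) / 2 - 1 = (exp (t / 4) - exp (- t / 4))\<^sup>2 / 2"
      by (simp add: power2_eq_square algebra_simps flip: exp_add)
    then have "exp (t / 2) / 2 + exp (- t / 2) / 2 - 1 \<ge> 0"
      by (simp only: zero_le_power2 divide_nonneg_pos zero_less_numeral)
    moreover have "(f has_real_derivative exp (t / 2) / 2 + exp (- t / 2) / 2 - 1) (at t)"
      unfolding f_def by (auto intro!: derivative_eq_intros)
    ultimately show "\<exists>y. (f has_real_derivative y) (at t) \<and> 0 \<le> y"
      by blast
  qed (use assms in auto)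
  then have "s * exp (s / 2) \<le> (exp (s / 2) - exp (- s / 2)) * exp (s / 2)"
    by (intro mult_right_mono) (auto simp: f_def)
  also have "\<dots> = exp s - 1"
    by (simp add: algebra_simps flip: exp_add)
  finally have "(s * exp (s / 2))\<^sup>2 \<le> (exp s - 1)\<^sup>2"
    using assms by (intro power_mono) auto
  then show ?thesis
    by (simp add: power_mult_distrib flip: exp_double)
qed

text \<open>The function is the logarithm of \<open>t * bose t\<close>. Its second derivative is
  nonpositive exactly by the bound \<open>two_sinh_half_ge\<close>.\<close>

lemma concave_ln_minus_ln_one_minus_exp: "concave_on {0<..} (\<lambda>t::real. ln t - ln (1 - exp (- t)))"
proof (rule f''_le0_imp_concave)
  fix t :: real assume "t \<in> {0<..}"
  then have t: "t > 0" and e: "exp t > 1" by auto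
  show "((\<lambda>t. ln t - ln (1 - exp (- t))) has_real_derivative 1 / t - 1 / (exp t - 1)) (at t)"
    using t e by (auto intro!: derivative_eq_intros simp: exp_minus field_simps)
  show "((\<lambda>t. 1 / t - 1 / (exp t - 1)) has_real_derivative - 1 / t\<^sup>2 + exp t / (exp t - 1)\<^sup>2) (at t)"
    using t e by (auto intro!: derivative_eq_intros simp: power2_eq_square)
  have "exp t / (exp t - 1)\<^sup>2 \<le> 1 / t\<^sup>2"
    using two_sinh_half_ge[OF t] t e by (simp add: divide_simps mult.commute)
  then show "- 1 / t\<^sup>2 + exp t / (exp t - 1)\<^sup>2 \<le> 0"
    by simp
qed simp

text \<open>Both v and r - v are convex combinations of u and r - u, with interchanged weights
  \<open>1 - l\<close> and \<open>l\<close>. Adding the two concavity inequalities removes the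
  weights.\<close>

lemma concave_on_add_reflect:
  fixes f :: "real \<Rightarrow> real"
  assumes f: "concave_on S f" and "u \<in> S" "r - u \<in> S" and "u \<le> v" "v \<le> r / 2"
  shows "f u + f (r - u) \<le> f v + f (r - v)"
proof (cases "u = v")
  case False
  define l where "l = (v - u) / (r - 2 * u)"
  have r: "r - 2 * u > 0" and l: "0 \<le> l" "l \<le> 1"
    using assms False by (auto simp: l_def field_simps)
  have lr: "l * (r - 2 * u) = v - u"
    using r by (simp add: l_def)
  have "(1 - l) *\<^sub>R u + l *\<^sub>R (r - u) = v" "(1 - l) *\<^sub>R (r - u) + l *\<^sub>R u = r - v"
    using lr by (auto simp: algebra_simps)
  with concave_onD[OF f l, of u "r - u"] concave_onD[OF f l, of "r - u" u] assms
  show ?thesis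
    by (simp add: algebra_simps)
qed simp

lemma mult_bose_product_mono:
  assumes "0 < u" "u \<le> v" "v \<le> r / 2"
  shows "(u * bose u) * ((r - u) * bose (r - u)) \<le> (v * bose v) * ((r - v) * bose (r - v))"
proof -
  have pos: "t * bose t > 0" if "t > 0" for t
    using that bose_pos by simp
  have ln: "ln t - ln (1 - exp (- t)) = ln (t * bose t)" if "t > 0" for t
    using that by (simp add: bose_def ln_div)
  have "ln (u * bose u) + ln ((r - u) * bose (r - u)) \<le> ln (v * bose v) + ln ((r - v) * bose (r - v))"
    using concave_on_add_reflect[OF concave_ln_minus_ln_one_minus_exp, of u r v] assms
      ln[of u] ln[of "r - u"] ln[of v] ln[of "r - v"]
    by simp
  then show ?thesis
    using assms pos[of u] pos[of "r - u"] pos[of v] pos[of "r - v"]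
    by (simp flip: ln_mult_pos)
qed

lemma mult_bose_submultiplicative:
  assumes "0 < s" "s < r"
  shows "r * bose r \<le> (s * bose s) * ((r - s) * bose (r - s))"
proof -
  \<comment> \<open>By symmetry s may be replaced by the nearer of the two points to 0, so that
    monotonicity on (0, r/2] applies.\<close>
  define v where "v = min s (r - s)"
  have v: "0 < v" "v \<le> r / 2"
    using assms by (auto simp: v_def min_def)
  have "isCont (\<lambda>u. (r - u) * bose (r - u)) 0"
    using assms unfolding bose_def by (intro continuous_intros) auto
  then have "((\<lambda>u. (r - u) * bose (r - u)) \<longlongrightarrow> r * bose r) (at_right 0)"
    unfolding isCont_def by (auto intro: tendsto_within_subset[of _ _ _ UNIV])
  moreover have "eventually (\<lambda>u. (r - u) * bose (r - u) \<le> (v * bose v) * ((r - v) * bose (r - v))) (at_right 0)"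
    using eventually_at_right_real[OF v(1)]
  proof eventually_elim
    case (elim u)
    have "1 - exp (- u) \<le> u"
      using exp_ge_add_one_self[of "- u"] by linarith
    then have "1 \<le> u * bose u"
      using elim by (simp add: bose_def field_simps)
    then have "1 * ((r - u) * bose (r - u)) \<le> (u * bose u) * ((r - u) * bose (r - u))"
      using elim v bose_pos[of "r - u"] by (intro mult_right_mono) auto
    also have "\<dots> \<le> (v * bose v) * ((r - v) * bose (r - v))"
      using elim v by (intro mult_bose_product_mono) auto
    finally show ?case by simp
  qed
  ultimately have "r * bose r \<le> (v * bose v) * ((r - v) * bose (r - v))"
    by (rule tendsto_upperbound) simp
  then show ?thesis
    by (auto simp: v_def min_def mult_ac split: if_splits)
qed

subsection \<open>Weighted Beta integrals\<close>

text \<open>This is monotonicity on [0, 1] of the quotient of z^m + z^n by z^p + z^q, with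
  denominators cleared. Since m + n = p + q, the exponents depend only on q and the two gaps
  \<open>a\<close> and \<open>k\<close>.\<close>

lemma power_sum_ratio_mono:
  fixes z y :: real
  assumes "0 \<le> z" "z \<le> y" "y \<le> 1" and "q \<le> n" "n \<le> m" "m + n = p + q"
  shows "(z ^ m + z ^ n) * (y ^ p + y ^ q) \<le> (y ^ m + y ^ n) * (z ^ p + z ^ q)"
proof -
  define a where "a = n - q"
  define k where "k = m - n"
  have e: "n = q + a" "m = q + a + k" "p = q + (a + (a + k))"
    using assms by (auto simp: a_def k_def)
  have "z * y \<le> 1"
    using assms by (simp add: mult_le_one)
  then have *: "(y ^ i - z ^ i) * (1 - (z * y) ^ j) \<ge> 0" for i j
    using assms by (intro mult_nonneg_nonneg) (auto intro: power_mono power_le_one)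
  \<comment> \<open>The cross difference factors into terms that are nonnegative for 0 <= z <= y <=
    1.\<close>
  have "(y ^ m + y ^ n) * (z ^ p + z ^ q) - (z ^ m + z ^ n) * (y ^ p + y ^ q)
      = (z * y) ^ q * ((y ^ a - z ^ a) * (1 - (z * y) ^ (a + k)) + (y ^ (a + k) - z ^ (a + k)) * (1 - (z * y) ^ a))"
    by (simp add: e power_add power_mult_distrib algebra_simps)
  also have "\<dots> \<ge> 0"
    using assms by (intro mult_nonneg_nonneg[OF zero_le_power] add_nonneg_nonneg *) auto
  finally show ?thesis by simp
qed

text \<open>The Beta integrand plus its reflection under s -> r - s, not halved; this is the source
  of the factors 2 below.\<close>

definition beta_sym :: "nat \<Rightarrow> nat \<Rightarrow> real \<Rightarrow> real \<Rightarrow> real" where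
  "beta_sym a b r s = s ^ a * (r - s) ^ b + s ^ b * (r - s) ^ a"

lemma measurable_beta_sym [measurable]: "beta_sym a b r \<in> borel_measurable borel"
  unfolding beta_sym_def by measurable

lemma beta_sym_nonneg: "0 < s \<Longrightarrow> s < r \<Longrightarrow> beta_sym a b r s \<ge> 0"
  by (simp add: beta_sym_def)

lemma beta_sym_reflect: "beta_sym a b r (r - s) = beta_sym a b r s"
  by (simp add: beta_sym_def mult.commute)

lemma beta_sym_Suc:
  "beta_sym (Suc a) (Suc b) r s = s * (r - s) * beta_sym a b r s"
  by (simp add: beta_sym_def algebra_simps)

text \<open>By homogeneity a power of r - s splits off, leaving powers of s / (r - s), which
  increases up to 1 on (0, r/2]. The split-off powers agree because m + n = p + q.\<close>

lemma beta_sym_ratio_mono: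
  assumes "0 < u" "u \<le> v" "v \<le> r / 2" and "q \<le> n" "n \<le> m" "m + n = p + q"
  shows "beta_sym m n r u * beta_sym p q r v \<le> beta_sym m n r v * beta_sym p q r u"
proof -
  define z where "z = (\<lambda>s. s / (r - s))"
  have z: "beta_sym a b r s = (r - s) ^ (a + b) * (z s ^ a + z s ^ b)" if "s \<le> r / 2" "s > 0" for s a b
    using that by (simp add: beta_sym_def z_def power_divide power_add field_simps)
  \<comment> \<open>This is \<open>z u \<le> z v\<close> after clearing denominators and cancelling
    u * v.\<close>
  have "u * r \<le> v * r"
    using assms by (intro mult_right_mono) auto
  then have "0 \<le> z u" "z u \<le> z v" "z v \<le> 1"
    using assms by (auto simp: z_def divide_simps algebra_simps)
  then have "(z u ^ m + z u ^ n) * (z v ^ p + z v ^ q) \<le> (z v ^ m + z v ^ n) * (z u ^ p + z u ^ q)"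
    using assms by (intro power_sum_ratio_mono)
  then have "((r - u) ^ (m + n) * (r - v) ^ (m + n)) * ((z u ^ m + z u ^ n) * (z v ^ p + z v ^ q))
    \<le> ((r - u) ^ (m + n) * (r - v) ^ (m + n)) * ((z v ^ m + z v ^ n) * (z u ^ p + z u ^ q))"
    using assms by (intro mult_left_mono) auto
  then show ?thesis
    using assms by (simp add: z mult_ac)
qed

lemma has_integral_power_mult_power:
  fixes r :: real
  assumes "r \<ge> 0"
  shows "((\<lambda>s. s ^ a * (r - s) ^ b) has_integral (fact a * fact b / fact (a + b + 1) * r ^ (a + b + 1))) {0..r}"
proof (induction b arbitrary: a)
  case 0
  have "((\<lambda>s. s ^ a) has_integral (r ^ Suc a / Suc a - 0 ^ Suc a / Suc a)) {0..r}"
    using assms by (intro fundamental_theorem_of_calculus)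
      (auto intro!: derivative_eq_intros simp flip: has_real_derivative_iff_has_vector_derivative simp del: power_Suc)
  then show ?case
    by simp
next
  case (Suc b)
  \<comment> \<open>Integration by parts: the integrand is the derivative of
    \<open>s ^ Suc a * (r - s) ^ Suc b\<close>, whose boundary values vanish.\<close>
  have "((\<lambda>s. Suc a * s ^ a * (r - s) ^ Suc b - Suc b * s ^ Suc a * (r - s) ^ b) has_integral
      (r ^ Suc a * (r - r) ^ Suc b - 0 ^ Suc a * (r - 0) ^ Suc b)) {0..r}"
    using assms by (intro fundamental_theorem_of_calculus)
      (auto intro!: derivative_eq_intros simp flip: has_real_derivative_iff_has_vector_derivative simp del: power_Suc)
  then have 1: "((\<lambda>s. Suc a * s ^ a * (r - s) ^ Suc b - Suc b * s ^ Suc a * (r - s) ^ b) has_integral 0) {0..r}"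
    by simp
  have 2: "((\<lambda>s. Suc b * s ^ Suc a * (r - s) ^ b) has_integral
      Suc b * (fact (Suc a) * fact b / fact (Suc a + b + 1) * r ^ (Suc a + b + 1))) {0..r}"
    using has_integral_mult_right[OF Suc.IH[of "Suc a"], of "real (Suc b)"] by (simp only: mult.assoc)
  have "((\<lambda>s. inverse (real (Suc a)) * (Suc a * s ^ a * (r - s) ^ Suc b)) has_integral inverse (real (Suc a)) *
      (Suc b * (fact (Suc a) * fact b / fact (Suc a + b + 1) * r ^ (Suc a + b + 1)))) {0..r}"
    using has_integral_mult_right[OF has_integral_add[OF 1 2], of "inverse (real (Suc a))"] by simp
  moreover have "inverse (real (Suc a)) * (Suc b * (fact (Suc a) * fact b / fact (Suc a + b + 1) * r ^ (Suc a + b + 1)))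
      = fact a * fact (Suc b) / fact (a + Suc b + 1) * r ^ (a + Suc b + 1)"
    by (simp add: field_simps del: of_nat_Suc power_Suc)
  moreover have "inverse (real (Suc a)) * (Suc a * s ^ a * (r - s) ^ Suc b) = s ^ a * (r - s) ^ Suc b" for s :: real
    by (simp add: field_simps del: of_nat_Suc power_Suc)
  ultimately show ?case
    by (simp only:)
qed

lemma nn_integral_beta_sym:
  assumes "r > 0"
  shows "(\<integral>\<^sup>+s. ennreal (indicator {0<..<r} s * beta_sym a b r s) \<partial>lborel)
       = ennreal (2 * fact a * fact b / fact (a + b + 1) * r ^ (a + b + 1))"
proof -
  have "((\<lambda>s. beta_sym a b r s) has_integral
     (fact a * fact b / fact (a + b + 1) * r ^ (a + b + 1) + fact b * fact a / fact (b + a + 1) * r ^ (b + a + 1))) {0..r}"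
    unfolding beta_sym_def using assms by (intro has_integral_add has_integral_power_mult_power) auto
  then have "((\<lambda>s. beta_sym a b r s) has_integral (2 * fact a * fact b / fact (a + b + 1) * r ^ (a + b + 1))) {0<..<r}"
    by (simp add: has_integral_Icc_iff_Ioo add.commute mult_ac)
  from nn_integral_has_integral_lebesgue[OF _ this] show ?thesis
    by (simp add: beta_sym_nonneg)
qed

section \<open>Chebyshev's integral inequality and the comparison of weighted Beta integrals\<close>

text \<open>Integrate the pointwise hypothesis over both variables.\<close>

lemma nn_integral_chebyshev:
  fixes f g w :: "'a \<Rightarrow> real"
  assumes [measurable]: "f \<in> borel_measurable M" "g \<in> borel_measurable M" "w \<in> borel_measurable M"
    and nonneg: "\<And>s. f s \<ge> 0" "\<And>s. g s \<ge> 0" "\<And>s. w s \<ge> 0"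
    and sim: "\<And>s t. (f s * g t - f t * g s) * (w s - w t) \<ge> 0"
  shows "(\<integral>\<^sup>+s. g s * w s \<partial>M) * (\<integral>\<^sup>+s. f s \<partial>M) \<le> (\<integral>\<^sup>+s. f s * w s \<partial>M) * (\<integral>\<^sup>+s. g s \<partial>M)"
proof -
  \<comment> \<open>The integrand is a sum of two products in separated variables, exchanged by
    swapping s and t; hence the factor 2.\<close>
  have double: "(\<integral>\<^sup>+s. \<integral>\<^sup>+t. ennreal (b s * w s * a t + b t * w t * a s) \<partial>M \<partial>M)
      = 2 * ((\<integral>\<^sup>+s. b s * w s \<partial>M) * (\<integral>\<^sup>+s. a s \<partial>M))"
    if [measurable]: "a \<in> borel_measurable M" "b \<in> borel_measurable M"
      and "\<And>s. a s \<ge> 0" "\<And>s. b s \<ge> 0" for a b :: "'a \<Rightarrow> real"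
  proof -
    have "(\<integral>\<^sup>+t. ennreal (b s * w s * a t + b t * w t * a s) \<partial>M)
        = ennreal (b s * w s) * (\<integral>\<^sup>+t. a t \<partial>M) + (\<integral>\<^sup>+t. b t * w t \<partial>M) * ennreal (a s)" for s
      using that nonneg by (simp add: ennreal_mult' nn_integral_add nn_integral_cmult nn_integral_multc)
    then show ?thesis
      by (simp add: nn_integral_add nn_integral_cmult nn_integral_multc mult_2 mult.commute)
  qed
  have "f t * w t * g s + f s * w s * g t - (g s * w s * f t + g t * w t * f s) \<ge> 0" for s t
    using sim[of s t] by (simp add: algebra_simps)
  then have "(\<integral>\<^sup>+s. \<integral>\<^sup>+t. ennreal (g s * w s * f t + g t * w t * f s) \<partial>M \<partial>M)
      \<le> (\<integral>\<^sup>+s. \<integral>\<^sup>+t. ennreal (f s * w s * g t + f t * w t * g s) \<partial>M \<partial>M)"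
    by (intro nn_integral_mono ennreal_leI) (simp add: add.commute)
  then have "2 * ((\<integral>\<^sup>+s. g s * w s \<partial>M) * (\<integral>\<^sup>+s. f s \<partial>M)) \<le> 2 * ((\<integral>\<^sup>+s. f s * w s \<partial>M) * (\<integral>\<^sup>+s. g s \<partial>M))"
    using nonneg by (simp only: double assms)
  then show ?thesis
    by (simp add: ennreal_mult_le_mult_iff)
qed

lemma nn_integral_chebyshev_symmetric:
  fixes f g w :: "real \<Rightarrow> real"
  assumes [measurable]: "f \<in> borel_measurable borel" "g \<in> borel_measurable borel" "w \<in> borel_measurable borel"
    and nonneg: "\<And>s. 0 < s \<Longrightarrow> s < r \<Longrightarrow> f s \<ge> 0 \<and> g s \<ge> 0 \<and> w s \<ge> 0"
    and refl: "\<And>s. f (r - s) = f s" "\<And>s. g (r - s) = g s" "\<And>s. w (r - s) = w s"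
    and sim: "\<And>u v. 0 < u \<Longrightarrow> u \<le> v \<Longrightarrow> v \<le> r / 2 \<Longrightarrow> (f v * g u - f u * g v) * (w v - w u) \<ge> 0"
  shows "(\<integral>\<^sup>+s. indicator {0<..<r} s * (g s * w s) \<partial>lborel) * (\<integral>\<^sup>+s. indicator {0<..<r} s * f s \<partial>lborel)
       \<le> (\<integral>\<^sup>+s. indicator {0<..<r} s * (f s * w s) \<partial>lborel) * (\<integral>\<^sup>+s. indicator {0<..<r} s * g s \<partial>lborel)"
proof -
  define I :: "real \<Rightarrow> real" where "I = indicator {0<..<r}"
  have [measurable]: "I \<in> borel_measurable borel"
    by (simp add: I_def)
  have "(f s * g t - f t * g s) * (w s - w t) \<ge> 0" if "s \<in> {0<..<r}" "t \<in> {0<..<r}" for s t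
  proof -
    \<comment> \<open>Folding (0, r) onto (0, r/2] changes none of the functions, so it suffices to
      compare points of the half interval.\<close>
    define h where "h = (\<lambda>s. min s (r - s))"
    have h: "f (h s) = f s" "g (h s) = g s" "w (h s) = w s" for s
      by (auto simp: h_def min_def refl)
    have *: "0 < h s" "h s \<le> r / 2" "0 < h t" "h t \<le> r / 2"
      using that by (auto simp: h_def min_def)
    show ?thesis
    proof (cases "h t \<le> h s")
      case True
      with sim[of "h t" "h s"] * show ?thesis by (simp add: h)
    next
      case False
      with sim[of "h s" "h t"] * show ?thesis by (simp add: h algebra_simps)
    qed
  qed
  \<comment> \<open>If s or t lies outside (0, r), the first factor vanishes.\<close>
  then have "(I s * f s * (I t * g t) - I t * f t * (I s * g s)) * (I s * w s - I t * w t) \<ge> 0" for s t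
    by (auto simp: I_def indicator_def)
  then have "(\<integral>\<^sup>+s. I s * g s * (I s * w s) \<partial>lborel) * (\<integral>\<^sup>+s. I s * f s \<partial>lborel)
       \<le> (\<integral>\<^sup>+s. I s * f s * (I s * w s) \<partial>lborel) * (\<integral>\<^sup>+s. I s * g s \<partial>lborel)"
    using nonneg by (intro nn_integral_chebyshev) (auto simp: I_def indicator_def)
  moreover have "I s * x * (I s * y) = I s * (x * y)" for s x y
    by (auto simp: I_def indicator_def)
  ultimately show ?thesis
    by (simp only: I_def)
qed

text \<open>Chebyshev's inequality with the unweighted integrals evaluated as Beta integrals. Their
  common factor \<open>C\<close> cancels because m + n = p + q, leaving only factorials.\<close>

lemma nn_integral_beta_sym_weight_mono:
  fixes w :: "real \<Rightarrow> real"
  assumes [measurable]: "w \<in> borel_measurable borel" and r: "r > 0"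
    and w: "\<And>s. 0 < s \<Longrightarrow> s < r \<Longrightarrow> w s \<ge> 0" "\<And>s. w (r - s) = w s"
    and mn: "m + n = p + q"
    and sim: "\<And>u v. 0 < u \<Longrightarrow> u \<le> v \<Longrightarrow> v \<le> r / 2 \<Longrightarrow>
      (beta_sym m n r v * beta_sym p q r u - beta_sym m n r u * beta_sym p q r v) * (w v - w u) \<ge> 0"
  shows "ennreal (fact m * fact n) * (\<integral>\<^sup>+s. indicator {0<..<r} s * (beta_sym p q r s * w s) \<partial>lborel)
       \<le> ennreal (fact p * fact q) * (\<integral>\<^sup>+s. indicator {0<..<r} s * (beta_sym m n r s * w s) \<partial>lborel)"
proof -
  define A where "A = (\<integral>\<^sup>+s. indicator {0<..<r} s * (beta_sym p q r s * w s) \<partial>lborel)"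
  define B where "B = (\<integral>\<^sup>+s. indicator {0<..<r} s * (beta_sym m n r s * w s) \<partial>lborel)"
  define C where "C = 2 / fact (m + n + 1) * r ^ (m + n + 1)"
  have C: "C > 0"
    using r by (simp add: C_def)
  have int: "(\<integral>\<^sup>+s. ennreal (indicator {0<..<r} s * beta_sym a b r s) \<partial>lborel) = ennreal C * ennreal (fact a * fact b)"
    if "a + b = m + n" for a b
    using nn_integral_beta_sym[OF r, of a b] C that by (simp add: C_def mult_ac flip: ennreal_mult)
  have "A * (ennreal C * ennreal (fact m * fact n)) \<le> B * (ennreal C * ennreal (fact p * fact q))"
    using nn_integral_chebyshev_symmetric[of "beta_sym m n r" "beta_sym p q r" w r] w sim
    by (simp add: int mn beta_sym_nonneg beta_sym_reflect A_def B_def)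
  then have "ennreal C * (ennreal (fact m * fact n) * A) \<le> ennreal C * (ennreal (fact p * fact q) * B)"
    by (simp only: mult_ac)
  then show ?thesis
    using C by (simp add: ennreal_mult_le_mult_iff A_def B_def)
qed

text \<open>For the case q = 0: the factor s (r - s) joins the weight, which is then bounded below
  by the constant \<open>r * bose r\<close>, and a plain Beta integral remains.\<close>

lemma nn_integral_mult_bose_ge:
  assumes r: "r > 0"
  shows "ennreal (2 * fact a * fact b / fact (a + b + 1) * (r ^ (a + b + 2) * bose r))
    \<le> (\<integral>\<^sup>+s. indicator {0<..<r} s * (beta_sym (Suc a) (Suc b) r s * (bose s * bose (r - s))) \<partial>lborel)"
proof -
  have "ennreal (2 * fact a * fact b / fact (a + b + 1) * (r ^ (a + b + 2) * bose r))
      = ennreal (r * bose r) * ennreal (2 * fact a * fact b / fact (a + b + 1) * r ^ (a + b + 1))"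
    using r bose_pos[OF r] by (simp add: mult_ac flip: ennreal_mult)
  also have "\<dots> = (\<integral>\<^sup>+s. ennreal (r * bose r) * ennreal (indicator {0<..<r} s * beta_sym a b r s) \<partial>lborel)"
    by (simp add: nn_integral_cmult nn_integral_beta_sym r)
  also have "\<dots> = (\<integral>\<^sup>+s. indicator {0<..<r} s * (beta_sym a b r s * (r * bose r)) \<partial>lborel)"
    using r bose_pos[OF r] by (intro nn_integral_cong) (simp add: ac_simps flip: ennreal_mult')
  also have "\<dots> \<le> (\<integral>\<^sup>+s. indicator {0<..<r} s * (beta_sym a b r s * ((s * bose s) * ((r - s) * bose (r - s)))) \<partial>lborel)"
    by (intro nn_integral_mono ennreal_leI)
      (auto simp: indicator_def intro!: mult_left_mono mult_bose_submultiplicative beta_sym_nonneg)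
  finally show ?thesis
    by (simp add: beta_sym_Suc mult_ac)
qed

text \<open>The weight falls towards r/2 while the quotient rises, so Chebyshev applies with the two
  exponent pairs exchanged. This yields the constant d.\<close>

lemma nn_integral_beta_sym_bose_antimono:
  assumes r: "r > 0" and le: "q \<le> n" "n \<le> m" and mn: "m + n = p + q"
  shows "ennreal (fact p * fact q) * (\<integral>\<^sup>+s. indicator {0<..<r} s * (beta_sym m n r s * (bose s * bose (r - s))) \<partial>lborel)
    \<le> ennreal (fact m * fact n) * (\<integral>\<^sup>+s. indicator {0<..<r} s * (beta_sym p q r s * (bose s * bose (r - s))) \<partial>lborel)"
proof (rule nn_integral_beta_sym_weight_mono)
  fix u v assume uv: "0 < u" "u \<le> v" "v \<le> r / 2"
  have "beta_sym m n r u * beta_sym p q r v \<le> beta_sym m n r v * beta_sym p q r u"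
    by (rule beta_sym_ratio_mono[OF uv le mn])
  with bose_product_antimono[OF uv]
  show "(beta_sym p q r v * beta_sym m n r u - beta_sym p q r u * beta_sym m n r v) *
      (bose v * bose (r - v) - bose u * bose (r - u)) \<ge> 0"
    by (intro mult_nonpos_nonpos) (auto simp: mult.commute)
qed (use r mn bose_pos in \<open>auto simp: mult.commute less_imp_le\<close>)

text \<open>Moving one factor s (r - s) into the weight makes it rise towards r/2 and lowers every
  exponent by one. This yields the constant c.\<close>

lemma nn_integral_beta_sym_mult_bose_mono:
  assumes r: "r > 0" and le: "q \<le> n" "n \<le> m" and mn: "m + n = p + q"
  shows "ennreal (fact m * fact n) *
      (\<integral>\<^sup>+s. indicator {0<..<r} s * (beta_sym (Suc p) (Suc q) r s * (bose s * bose (r - s))) \<partial>lborel)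
    \<le> ennreal (fact p * fact q) *
      (\<integral>\<^sup>+s. indicator {0<..<r} s * (beta_sym (Suc m) (Suc n) r s * (bose s * bose (r - s))) \<partial>lborel)"
proof -
  define w where "w = (\<lambda>s. (s * bose s) * ((r - s) * bose (r - s)))"
  have eq: "beta_sym (Suc a) (Suc b) r s * (bose s * bose (r - s)) = beta_sym a b r s * w s" for a b s
    by (simp add: beta_sym_Suc w_def)
  show ?thesis
    unfolding eq
  proof (rule nn_integral_beta_sym_weight_mono)
    fix u v assume uv: "0 < u" "u \<le> v" "v \<le> r / 2"
    have "beta_sym m n r u * beta_sym p q r v \<le> beta_sym m n r v * beta_sym p q r u"
      by (rule beta_sym_ratio_mono[OF uv le mn])
    with mult_bose_product_mono[OF uv]
    show "(beta_sym m n r v * beta_sym p q r u - beta_sym m n r u * beta_sym p q r v) * (w v - w u) \<ge> 0"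
      by (intro mult_nonneg_nonneg) (auto simp: w_def)
  qed (use r mn bose_pos in \<open>auto simp: w_def mult.commute less_imp_le\<close>)
qed

subsection \<open>Laplace representation of products of polygamma functions\<close>

text \<open>This is g_k of the introduction. The convention for index 0 makes g_0 = 1.\<close>

definition abs_psi :: "nat \<Rightarrow> real \<Rightarrow> real" where
  "abs_psi k x = (-1) ^ (k + 1) * psi k x"

lemma abs_psi_0 [simp]: "abs_psi 0 x = 1"
  by (simp add: abs_psi_def psi_def)

lemma abs_psi_eq_suminf:
  assumes "k > 0"
  shows "abs_psi k x = fact k * (\<Sum>j. inverse ((x + real j) ^ Suc k))"
  using assms by (simp add: abs_psi_def psi_def Polygamma_def flip: mult.assoc power_add mult_2)

lemma has_field_derivative_abs_psi:
  assumes "k > 0" "x > 0"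
  shows "(abs_psi k has_real_derivative - abs_psi (Suc k) x) (at x)"
proof -
  have "x \<notin> \<int>\<^sub>\<le>\<^sub>0"
    using assms by (auto elim!: nonpos_Ints_cases)
  then have "(Polygamma k has_real_derivative Polygamma (Suc k) x) (at x)"
    by (rule has_field_derivative_Polygamma)
  from DERIV_cmult[OF this, of "(-1) ^ (k + 1)"] show ?thesis
    using assms by (simp add: abs_psi_def[abs_def] psi_def)
qed

lemma abs_psi_nonneg:
  assumes "x > 0"
  shows "abs_psi k x \<ge> 0"
proof (cases "k = 0")
  case False
  then have "summable (\<lambda>j. inverse ((x + real j) ^ Suc k))"
    using assms by (intro Polygamma_converges') auto
  then have "(\<Sum>j. inverse ((x + real j) ^ Suc k)) \<ge> 0"
    using assms by (intro suminf_nonneg) auto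
  then show ?thesis
    using False by (simp add: abs_psi_eq_suminf)
qed simp

text \<open>The Laplace integrand of g_k, extended by zero to the whole line so that translations
  and convolutions can be taken over \<open>lborel\<close>.\<close>

definition lap :: "nat \<Rightarrow> real \<Rightarrow> real \<Rightarrow> real" where
  "lap k x t = indicator {0<..} t * (t ^ k * bose t * exp (- x * t))"

lemma measurable_lap [measurable]: "lap k x \<in> borel_measurable borel"
  unfolding lap_def by measurable

lemma lap_nonneg: "lap k x t \<ge> 0"
  using bose_pos[of t] by (auto simp: lap_def indicator_def)

lemma nn_integral_power_exp:
  assumes "a > 0"
  shows "(\<integral>\<^sup>+t. ennreal (indicator {0<..} t * (t ^ k * exp (- a * t))) \<partial>lborel) = ennreal (fact k * inverse (a ^ Suc k))"
proof -
  \<comment> \<open>Up to a constant the integrand is an Erlang density, except possibly at t = 0;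
    the zeroth moment of that density is 1.\<close>
  have "(\<integral>\<^sup>+t. ennreal (indicator {0<..} t * (t ^ k * exp (- a * t))) \<partial>lborel)
      = (\<integral>\<^sup>+t. ennreal (fact k * inverse (a ^ Suc k)) * ennreal (erlang_density k a t) \<partial>lborel)"
    using assms
    by (intro nn_integral_cong_AE eventually_mono[OF AE_lborel_singleton[of 0]])
      (auto simp: erlang_density_def indicator_def field_simps simp flip: ennreal_mult)
  also have "\<dots> = ennreal (fact k * inverse (a ^ Suc k))"
    using nn_integral_erlang_ith_moment[OF assms, of k 0] by (simp add: nn_integral_cmult)
  finally show ?thesis .
qed

text \<open>Expanding \<open>bose\<close> as a geometric series and exchanging sum and integral,
  which is free for nonnegative terms, gives Gamma integrals that add up to the polygamma
  series.\<close>

lemma abs_psi_eq_nn_integral: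
  assumes k: "k > 0" and x: "x > 0"
  shows "ennreal (abs_psi k x) = (\<integral>\<^sup>+t. lap k x t \<partial>lborel)"
proof -
  define L where "L = (\<lambda>j t. indicator {0<..} t * (t ^ k * exp (- (x + real j) * t)))"
  have [measurable]: "L j \<in> borel_measurable borel" for j
    unfolding L_def by measurable
  have L: "(\<Sum>j. ennreal (L j t)) = ennreal (lap k x t)" for t
  proof (cases "t > 0")
    case True
    have "(\<lambda>j. exp (- t) ^ j) sums bose t"
      unfolding bose_def using True by (intro geometric_sums) auto
    then have "(\<lambda>j. (t ^ k * exp (- x * t)) * exp (- t) ^ j) sums ((t ^ k * exp (- x * t)) * bose t)"
      by (rule sums_mult)
    also have "(\<lambda>j. (t ^ k * exp (- x * t)) * exp (- t) ^ j) = (\<lambda>j. L j t)"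
      using True by (auto simp: L_def algebra_simps exp_add exp_diff exp_minus field_simps simp flip: exp_of_nat_mult)
    also have "(t ^ k * exp (- x * t)) * bose t = lap k x t"
      using True by (simp add: lap_def)
    finally have "(\<lambda>j. L j t) sums lap k x t" .
    moreover have "L j t \<ge> 0" for j
      using True by (simp add: L_def)
    ultimately show ?thesis
      by (rule suminf_ennreal_eq[rotated])
  qed (simp add: L_def lap_def)
  have "summable (\<lambda>j. inverse ((x + real j) ^ Suc k))"
    using k x by (intro Polygamma_converges') auto
  then have "ennreal (abs_psi k x) = (\<Sum>j. ennreal (fact k * inverse ((x + real j) ^ Suc k)))"
    using k x by (subst suminf_ennreal2) (auto simp: abs_psi_eq_suminf suminf_mult simp del: power_Suc intro: summable_mult)
  also have "\<dots> = (\<Sum>j. \<integral>\<^sup>+t. L j t \<partial>lborel)"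
    unfolding L_def using x by (subst nn_integral_power_exp) auto
  also have "\<dots> = (\<integral>\<^sup>+t. (\<Sum>j. ennreal (L j t)) \<partial>lborel)"
    by (intro nn_integral_suminf[symmetric]) auto
  finally show ?thesis
    by (simp add: L)
qed

section \<open>Derivatives of products and their integral representation\<close>

text \<open>For $m, n \ge 1$, \<open>leibniz k m n\<close> is $(-1)^k$ times the $k$-th derivative of $g_m g_n$.\<close>

fun leibniz :: "nat \<Rightarrow> nat \<Rightarrow> nat \<Rightarrow> real \<Rightarrow> real" where
  "leibniz 0 m n x = abs_psi m x * abs_psi n x"
| "leibniz (Suc k) m n x = leibniz k (Suc m) n x + leibniz k m (Suc n) x"

lemma leibniz_nonneg: "x > 0 \<Longrightarrow> leibniz k m n x \<ge> 0"
  by (induction k arbitrary: m n) (auto simp: abs_psi_nonneg)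

lemma leibniz_commute: "leibniz k m n x = leibniz k n m x"
  by (induction k arbitrary: m n) auto

lemma has_field_derivative_leibniz:
  assumes "x > 0" "m > 0" "n > 0"
  shows "(leibniz k m n has_real_derivative - leibniz (Suc k) m n x) (at x)"
  using assms(2,3)
proof (induction k arbitrary: m n)
  case 0
  then have "((\<lambda>x. abs_psi m x * abs_psi n x) has_real_derivative
      (- abs_psi (Suc m) x) * abs_psi n x + (- abs_psi (Suc n) x) * abs_psi m x) (at x)"
    using assms(1) by (intro DERIV_mult has_field_derivative_abs_psi)
  then show ?case
    by (simp add: mult.commute)
next
  case (Suc k)
  have "((\<lambda>x. leibniz k (Suc m) n x + leibniz k m (Suc n) x) has_real_derivative
      - leibniz (Suc k) (Suc m) n x + - leibniz (Suc k) m (Suc n) x) (at x)"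
    using Suc.prems by (intro DERIV_add Suc.IH) auto
  then show ?case
    by simp
qed

text \<open>Raising the index of one factor multiplies the integrand by s or by t, so each level of
  \<open>leibniz\<close> contributes a factor s + t.\<close>

lemma leibniz_eq_nn_integral:
  assumes "m > 0" "n > 0" "x > 0"
  shows "ennreal (leibniz k m n x) = (\<integral>\<^sup>+s. \<integral>\<^sup>+t. ennreal ((s + t) ^ k * (lap m x s * lap n x t)) \<partial>lborel \<partial>lborel)"
  using assms(1,2)
proof (induction k arbitrary: m n)
  case 0
  then show ?case
    using \<open>x > 0\<close>
    by (simp add: ennreal_mult' abs_psi_nonneg lap_nonneg abs_psi_eq_nn_integral nn_integral_cmult nn_integral_multc)
next
  case (Suc k)
  have "ennreal ((s + t) ^ Suc k * (lap m x s * lap n x t)) =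
    ennreal ((s + t) ^ k * (lap (Suc m) x s * lap n x t)) + ennreal ((s + t) ^ k * (lap m x s * lap (Suc n) x t))" for s t
  proof (cases "s > 0 \<and> t > 0")
    case True
    then have "(s + t) ^ Suc k * (lap m x s * lap n x t) =
        (s + t) ^ k * (lap (Suc m) x s * lap n x t) + (s + t) ^ k * (lap m x s * lap (Suc n) x t)"
      by (simp add: lap_def algebra_simps)
    with True show ?thesis
      by (simp add: lap_nonneg del: power_Suc)
  qed (auto simp: lap_def)
  then show ?case
    using Suc \<open>x > 0\<close> by (simp add: leibniz_nonneg nn_integral_add del: power_Suc)
qed

lemma nn_integral_convolution:
  fixes f :: "real \<Rightarrow> real \<Rightarrow> ennreal"
  assumes [measurable]: "case_prod f \<in> borel_measurable (borel \<Otimes>\<^sub>M borel)"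
  shows "(\<integral>\<^sup>+s. \<integral>\<^sup>+t. f s t \<partial>lborel \<partial>lborel) = (\<integral>\<^sup>+r. \<integral>\<^sup>+s. f s (r - s) \<partial>lborel \<partial>lborel)"
proof -
  have "(\<integral>\<^sup>+t. f s t \<partial>lborel) = (\<integral>\<^sup>+r. f s (r - s) \<partial>lborel)" for s
    by (subst nn_integral_real_affine[where c = 1 and t = "- s"]) simp_all
  then have "(\<integral>\<^sup>+s. \<integral>\<^sup>+t. f s t \<partial>lborel \<partial>lborel) = (\<integral>\<^sup>+s. \<integral>\<^sup>+r. f s (r - s) \<partial>lborel \<partial>lborel)"
    by simp
  also have "\<dots> = (\<integral>\<^sup>+r. \<integral>\<^sup>+s. f s (r - s) \<partial>lborel \<partial>lborel)"
    by (rule lborel_pair.Fubini') simp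
  finally show ?thesis .
qed

text \<open>Along the lines s + t = r the power and the exponential depend on r alone. Adding the
  representation with m and n exchanged symmetrises the inner integrand, hence the factor 2.\<close>

lemma leibniz_eq_nn_integral_beta_sym:
  assumes "m > 0" "n > 0" "x > 0"
  shows "ennreal (2 * leibniz k m n x) = (\<integral>\<^sup>+r. ennreal (indicator {0<..} r * (r ^ k * exp (- x * r))) *
    (\<integral>\<^sup>+s. indicator {0<..<r} s * (beta_sym m n r s * (bose s * bose (r - s))) \<partial>lborel) \<partial>lborel)"
proof -
  define f where "f = (\<lambda>m n s t. ennreal ((s + t) ^ k * (lap m x s * lap n x t)))"
  have [measurable]: "case_prod (f m n) \<in> borel_measurable (borel \<Otimes>\<^sub>M borel)" for m n
    unfolding f_def by measurable
  have L: "ennreal (leibniz k a b x) = (\<integral>\<^sup>+r. \<integral>\<^sup>+s. f a b s (r - s) \<partial>lborel \<partial>lborel)"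
    if "a > 0" "b > 0" for a b
  proof -
    have "ennreal (leibniz k a b x) = (\<integral>\<^sup>+s. \<integral>\<^sup>+t. f a b s t \<partial>lborel \<partial>lborel)"
      unfolding f_def by (rule leibniz_eq_nn_integral[OF that \<open>x > 0\<close>])
    also have "\<dots> = (\<integral>\<^sup>+r. \<integral>\<^sup>+s. f a b s (r - s) \<partial>lborel \<partial>lborel)"
      by (rule nn_integral_convolution) measurable
    finally show ?thesis .
  qed
  have sym: "f m n s (r - s) + f n m s (r - s) = ennreal (indicator {0<..} r * (r ^ k * exp (- x * r))) *
      ennreal (indicator {0<..<r} s * (beta_sym m n r s * (bose s * bose (r - s))))" for r s
  proof (cases "0 < s \<and> s < r")
    case True
    then have "r ^ k * (lap m x s * lap n x (r - s)) + r ^ k * (lap n x s * lap m x (r - s))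
      = (r ^ k * exp (- x * r)) * (beta_sym m n r s * (bose s * bose (r - s)))"
      by (simp add: lap_def beta_sym_def algebra_simps flip: exp_add)
    with True show ?thesis
      by (simp add: f_def lap_nonneg flip: ennreal_plus ennreal_mult')
  qed (auto simp: f_def lap_def)
  have "ennreal (2 * leibniz k m n x) = ennreal (leibniz k m n x) + ennreal (leibniz k n m x)"
    using assms by (simp add: leibniz_nonneg leibniz_commute[of k n m] flip: ennreal_plus)
  also have "\<dots> = (\<integral>\<^sup>+r. \<integral>\<^sup>+s. f m n s (r - s) \<partial>lborel \<partial>lborel) + (\<integral>\<^sup>+r. \<integral>\<^sup>+s. f n m s (r - s) \<partial>lborel \<partial>lborel)"
    by (simp only: L assms)
  also have "\<dots> = (\<integral>\<^sup>+r. \<integral>\<^sup>+s. f m n s (r - s) + f n m s (r - s) \<partial>lborel \<partial>lborel)"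
    by (simp add: nn_integral_add)
  also have "\<dots> = (\<integral>\<^sup>+r. \<integral>\<^sup>+s. ennreal (indicator {0<..} r * (r ^ k * exp (- x * r))) *
      ennreal (indicator {0<..<r} s * (beta_sym m n r s * (bose s * bose (r - s)))) \<partial>lborel \<partial>lborel)"
    by (simp only: sym)
  finally show ?thesis
    by (simp add: nn_integral_cmult)
qed

subsection \<open>Complete monotonicity\<close>

text \<open>Here \<open>f k\<close> is $(-1)^k$ times the $k$-th derivative of \<open>f 0\<close>.\<close>

lemma completely_monotonic_onI:
  assumes der: "\<And>k x. x > 0 \<Longrightarrow> (f k has_real_derivative - f (Suc k) x) (at x)"
    and nonneg: "\<And>k x. x > 0 \<Longrightarrow> f k x \<ge> 0"
  shows "completely_monotonic_on {0<..} (f 0)"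
proof -
  have eq: "(deriv ^^ k) (f 0) x = (-1) ^ k * f k x" if "x > 0" for k x
    using that
  proof (induction k arbitrary: x)
    case (Suc k)
    have "eventually (\<lambda>y. y \<in> {0<..}) (nhds x)"
      using Suc.prems by (intro eventually_nhds_in_open) auto
    then have "eventually (\<lambda>y. (deriv ^^ k) (f 0) y = (-1) ^ k * f k y) (nhds x)"
      by eventually_elim (simp add: Suc.IH)
    then have "(deriv ^^ Suc k) (f 0) x = deriv (\<lambda>y. (-1) ^ k * f k y) x"
      by (simp add: deriv_cong_ev)
    also have "\<dots> = (-1) ^ k * - f (Suc k) x"
      using Suc.prems by (intro DERIV_imp_deriv DERIV_cmult der)
    finally show ?case
      by simp
  qed simp
  have "(deriv ^^ k) (f 0) differentiable (at x)" if "x > 0" for k x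
  proof -
    have "((\<lambda>y. (-1) ^ k * f k y) has_real_derivative (-1) ^ k * - f (Suc k) x) (at x)"
      using that by (intro DERIV_cmult der)
    then have "((deriv ^^ k) (f 0) has_real_derivative (-1) ^ k * - f (Suc k) x) (at x)"
      by (rule has_field_derivative_transform_within_open[where S = "{0<..}"]) (auto simp: eq that)
    then show ?thesis
      by (auto simp: real_differentiable_def)
  qed
  then show ?thesis
    using nonneg by (auto simp: completely_monotonic_on_def eq simp flip: mult.assoc power_add mult_2)
qed

text \<open>Comparing the inner integrals for each r suffices, since they are integrated against the
  same nonnegative function \<open>e\<close>, which contains the dependence on k and x.\<close>

lemma leibniz_le_leibniz:
  assumes "x > 0" "m > 0" "n > 0" "p > 0" "q > 0" and c: "c \<ge> 0" "d \<ge> 0"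
    and le: "\<And>r. r > 0 \<Longrightarrow>
      ennreal c * (\<integral>\<^sup>+s. indicator {0<..<r} s * (beta_sym p q r s * (bose s * bose (r - s))) \<partial>lborel)
    \<le> ennreal d * (\<integral>\<^sup>+s. indicator {0<..<r} s * (beta_sym m n r s * (bose s * bose (r - s))) \<partial>lborel)"
  shows "c * leibniz k p q x \<le> d * leibniz k m n x"
proof -
  define I where "I = (\<lambda>m n r. \<integral>\<^sup>+s. indicator {0<..<r} s * (beta_sym m n r s * (bose s * bose (r - s))) \<partial>lborel)"
  define e where "e = (\<lambda>r. ennreal (indicator {0<..} r * (r ^ k * exp (- x * r))))"
  have [measurable]: "I m n \<in> borel_measurable borel" for m n
    \<comment> \<open>The domain (0, r) varies with r, so the indicator is opened to obtain joint
      measurability in r and s.\<close>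
    unfolding I_def beta_sym_def indicator_def greaterThanLessThan_iff by measurable
  have [measurable]: "e \<in> borel_measurable borel"
    unfolding e_def by measurable
  have L: "ennreal (y * (2 * leibniz k a b x)) = (\<integral>\<^sup>+r. ennreal y * (e r * I a b r) \<partial>lborel)"
    if "y \<ge> 0" "a > 0" "b > 0" for y a b
  proof -
    have "ennreal (y * (2 * leibniz k a b x)) = ennreal y * ennreal (2 * leibniz k a b x)"
      using that by (intro ennreal_mult')
    also have "ennreal (2 * leibniz k a b x) = (\<integral>\<^sup>+r. e r * I a b r \<partial>lborel)"
      unfolding e_def I_def by (rule leibniz_eq_nn_integral_beta_sym[OF that(2,3) \<open>x > 0\<close>])
    finally show ?thesis
      by (simp add: nn_integral_cmult)
  qed
  have "ennreal (c * (2 * leibniz k p q x)) = (\<integral>\<^sup>+r. ennreal c * (e r * I p q r) \<partial>lborel)"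
    using assms by (intro L)
  also have "\<dots> \<le> (\<integral>\<^sup>+r. ennreal d * (e r * I m n r) \<partial>lborel)"
  proof (rule nn_integral_mono)
    fix r
    show "ennreal c * (e r * I p q r) \<le> ennreal d * (e r * I m n r)"
    proof (cases "r > 0")
      case True
      then have "e r * (ennreal c * I p q r) \<le> e r * (ennreal d * I m n r)"
        by (intro mult_left_mono) (auto simp: I_def le)
      then show ?thesis
        by (simp only: mult_ac)
    qed (simp add: e_def)
  qed
  also have "\<dots> = ennreal (d * (2 * leibniz k m n x))"
    using assms by (intro L[symmetric])
  finally show ?thesis
    using assms by (simp add: leibniz_nonneg ennreal_le_iff)
qed

text \<open>The extra factor \<open>r ^ k * exp (- x * r)\<close> turns the lower bound of
  \<open>nn_integral_mult_bose_ge\<close> into the Laplace integrand of g with index a + b + 2 +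
  k.\<close>

lemma abs_psi_le_leibniz:
  assumes "x > 0"
  shows "fact a * fact b / fact (a + b + 1) * abs_psi (a + b + 2 + k) x \<le> leibniz k (Suc a) (Suc b) x"
proof -
  define C :: real where "C = 2 * fact a * fact b / fact (a + b + 1)"
  have "ennreal (C * abs_psi (a + b + 2 + k) x) = (\<integral>\<^sup>+r. ennreal C * ennreal (lap (a + b + 2 + k) x r) \<partial>lborel)"
    using assms by (subst ennreal_mult') (auto simp: C_def abs_psi_eq_nn_integral nn_integral_cmult)
  also have "\<dots> \<le> (\<integral>\<^sup>+r. ennreal (indicator {0<..} r * (r ^ k * exp (- x * r))) *
    (\<integral>\<^sup>+s. indicator {0<..<r} s * (beta_sym (Suc a) (Suc b) r s * (bose s * bose (r - s))) \<partial>lborel) \<partial>lborel)"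
  proof (rule nn_integral_mono)
    fix r
    show "ennreal C * ennreal (lap (a + b + 2 + k) x r) \<le> ennreal (indicator {0<..} r * (r ^ k * exp (- x * r))) *
      (\<integral>\<^sup>+s. indicator {0<..<r} s * (beta_sym (Suc a) (Suc b) r s * (bose s * bose (r - s))) \<partial>lborel)"
    proof (cases "r > 0")
      case True
      then have "ennreal C * ennreal (lap (a + b + 2 + k) x r)
        = ennreal (r ^ k * exp (- x * r)) * ennreal (C * (r ^ (a + b + 2) * bose r))"
        by (simp add: lap_def C_def power_add mult_ac flip: ennreal_mult')
      also have "\<dots> \<le> ennreal (r ^ k * exp (- x * r)) *
        (\<integral>\<^sup>+s. indicator {0<..<r} s * (beta_sym (Suc a) (Suc b) r s * (bose s * bose (r - s))) \<partial>lborel)"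
        unfolding C_def using True by (intro mult_left_mono nn_integral_mult_bose_ge) auto
      finally show ?thesis
        using True by simp
    qed (simp add: lap_def)
  qed
  also have "\<dots> = ennreal (2 * leibniz k (Suc a) (Suc b) x)"
    using assms by (intro leibniz_eq_nn_integral_beta_sym[symmetric]) auto
  finally show ?thesis
    using assms by (simp add: leibniz_nonneg C_def)
qed

lemma F_eq_abs_psi:
  "F p m n q c x = abs_psi m x * abs_psi n x - c * (abs_psi p x * abs_psi q x)"
  by (simp add: F_def abs_psi_def power_add)

theorem theorem5p1:
  fixes p m n q :: nat
  assumes "p > m" and "m \<ge> n" and "n > q" and "m + n = p + q"
  shows "completely_monotonic_on {0<..} (\<lambda>x. F p m n q (c_const p m n q) x) \<and>
         (q > 0 \<longrightarrow> completely_monotonic_on {0<..} (\<lambda>x. - F p m n q (d_const p m n q) x))"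
proof (intro conjI impI)
  have pos: "m > 0" "n > 0" "p > 0"
    using assms by auto
  show "completely_monotonic_on {0<..} (\<lambda>x. F p m n q (c_const p m n q) x)"
  proof (cases "q = 0")
    case True
    define c where "c = c_const p m n q"
    \<comment> \<open>As g_0 = 1, the second product is g_p alone, and each derivative raises its
      index by one.\<close>
    define f where "f = (\<lambda>k x. leibniz k m n x - c * abs_psi (p + k) x)"
    \<comment> \<open>For q = 0 one has m + n = p, so the Beta denominator is (p - 1)!, as in the
      definition of c.\<close>
    have eq: "m - 1 + (n - 1) + 1 = p - 1"
      using pos True assms by simp
    have c: "c = fact (m - 1) * fact (n - 1) / fact (m - 1 + (n - 1) + 1)"
      using eq True by (simp only: c_def c_const_def) simp
    have "completely_monotonic_on {0<..} (f 0)"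
    proof (rule completely_monotonic_onI)
      fix k and x :: real assume x: "x > 0"
      have "((\<lambda>x. leibniz k m n x - c * abs_psi (p + k) x) has_real_derivative
          - leibniz (Suc k) m n x - c * (- abs_psi (Suc (p + k)) x)) (at x)"
        using x pos by (intro DERIV_diff DERIV_cmult has_field_derivative_leibniz has_field_derivative_abs_psi) auto
      then show "(f k has_real_derivative - f (Suc k) x) (at x)"
        by (simp add: f_def algebra_simps)
      have "Suc (m - 1) = m" "Suc (n - 1) = n" "m - 1 + (n - 1) + 2 + k = p + k"
        using pos True assms by auto
      then have "c * abs_psi (p + k) x \<le> leibniz k m n x"
        using abs_psi_le_leibniz[OF x, of "m - 1" "n - 1" k] by (simp only: c)
      then show "f k x \<ge> 0"
        by (simp add: f_def)
    qed
    also have "f 0 = (\<lambda>x. F p m n q (c_const p m n q) x)"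
      using True by (simp add: f_def c_def F_eq_abs_psi)
    finally show ?thesis .
  next
    case False
    define c where "c = c_const p m n q"
    define f where "f = (\<lambda>k x. leibniz k m n x - c * leibniz k p q x)"
    have "completely_monotonic_on {0<..} (f 0)"
    proof (rule completely_monotonic_onI)
      fix k and x :: real assume x: "x > 0"
      have "((\<lambda>x. leibniz k m n x - c * leibniz k p q x) has_real_derivative
          - leibniz (Suc k) m n x - c * (- leibniz (Suc k) p q x)) (at x)"
        using x pos False by (intro DERIV_diff DERIV_cmult has_field_derivative_leibniz) auto
      then show "(f k has_real_derivative - f (Suc k) x) (at x)"
        by (simp add: f_def algebra_simps)
      \<comment> \<open>The comparison is used with all four exponents lowered by one, which is
        possible as q >= 1.\<close>
      have "(fact (m - 1) * fact (n - 1)) * leibniz k p q x \<le> (fact (p - 1) * fact (q - 1)) * leibniz k m n x"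
        using nn_integral_beta_sym_mult_bose_mono[of _ "q - 1" "n - 1" "m - 1" "p - 1"] x pos False assms
        by (intro leibniz_le_leibniz) auto
      then show "f k x \<ge> 0"
        using False by (simp add: f_def c_def c_const_def field_simps)
    qed
    also have "f 0 = (\<lambda>x. F p m n q (c_const p m n q) x)"
      by (simp add: f_def c_def F_eq_abs_psi)
    finally show ?thesis .
  qed
  assume q: "q > 0"
  define d where "d = d_const p m n q"
  define f where "f = (\<lambda>k x. d * leibniz k p q x - leibniz k m n x)"
  have "completely_monotonic_on {0<..} (f 0)"
  proof (rule completely_monotonic_onI)
    fix k and x :: real assume x: "x > 0"
    have "((\<lambda>x. d * leibniz k p q x - leibniz k m n x) has_real_derivative
        d * (- leibniz (Suc k) p q x) - (- leibniz (Suc k) m n x)) (at x)"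
      using x pos q by (intro DERIV_diff DERIV_cmult has_field_derivative_leibniz) auto
    then show "(f k has_real_derivative - f (Suc k) x) (at x)"
      by (simp add: f_def algebra_simps)
    \<comment> \<open>Here the pairs (m, n) and (p, q) change places, which reverses the inequality
      and replaces c by d.\<close>
    have "(fact p * fact q) * leibniz k m n x \<le> (fact m * fact n) * leibniz k p q x"
      using x pos q assms by (intro leibniz_le_leibniz nn_integral_beta_sym_bose_antimono) auto
    then show "f k x \<ge> 0"
      by (simp add: f_def d_def d_const_def field_simps)
  qed
  also have "f 0 = (\<lambda>x. - F p m n q (d_const p m n q) x)"
    by (simp add: f_def d_def F_eq_abs_psi)
  finally show "completely_monotonic_on {0<..} (\<lambda>x. - F p m n q (d_const p m n q) x)" .
qed

end
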